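(* Let $n\ge1$ and consider the determinant $$\Delta_n(x_1,\dots,x_n)=\begin{vmatrix}x_1^{\alpha_1}&\cdots&x_n^{\alpha_1}\\ x_1^{\alpha_2}&\cdots&x_n^{\alpha_2}\\ \vdots&&\vdots\\ x_1^{\alpha_n}&\cdots&x_n^{\alpha_n}\end{vmatrix}.$$ Then, for any $\alpha_1,\dots,\alpha_n\in\mathbb R$ with $\alpha_1<\dots<\alpha_n$ and any $0<x_1<\dots<x_n$, we have $\Delta_n(x_1,\dots,x_n)>0$. *)

theory Defs
  imports Complex_Main "Jordan_Normal_Form.Determinant"
begin

(* Matrices are indexed from 0, the families \<alpha> and x from 1; hence the Suc. *)
definition Delta :: "nat \<Rightarrow> (nat \<Rightarrow> real) \<Rightarrow> (nat \<Rightarrow> real) \<Rightarrow> real" where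
  "Delta n \<alpha> x = det (mat n n (\<lambda>(i, j). x (Suc j) powr \<alpha> (Suc i)))"

end

theory Submission
  imports Defs
begin

text \<open>A generalized polynomial \<open>\<Sum>i\<le>n. c i * t powr \<alpha> i\<close> with positive leading coefficient and
  \<open>n\<close> positive zeros is positive to the right of them: divide by the lowest power and
  differentiate, which removes one term, while by Rolle's theorem at most one zero is lost.
  Viewed as a function of its last variable, the determinant is such a generalized polynomial:
  it vanishes at the preceding variables, and its leading coefficient is the determinant of
  size \<open>n - 1\<close>.\<close>

lemma gen_poly_pos_right_of_zeros:
  fixes c \<alpha> z :: "nat \<Rightarrow> real"
  assumes "strict_mono_on {..n} \<alpha>" and "c n > 0"
    and "strict_mono_on {..<n} z"
    and "\<And>i. i < n \<Longrightarrow> 0 < z i"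
    and "\<And>i. i < n \<Longrightarrow> (\<Sum>k\<le>n. c k * z i powr \<alpha> k) = 0"
    and "0 < t" and "\<And>i. i < n \<Longrightarrow> z i < t"
  shows "0 < (\<Sum>k\<le>n. c k * t powr \<alpha> k)"
  using assms
proof (induction n arbitrary: c \<alpha> z t)
  case 0
  then show ?case by simp
next
  case (Suc n)
  note mono_\<alpha> = strict_mono_onD[OF Suc.prems(1)] and mono_z = strict_mono_onD[OF Suc.prems(3)]
  \<comment> \<open>Dividing by \<open>s powr \<alpha> 0\<close> keeps sign and zeros on the
    positive axis and makes the term for \<open>k = 0\<close> constant, so differentiation removes
    it. The index shift in \<open>c'\<close> and \<open>\<alpha>'\<close> closes that gap.\<close>
  define g where "g s = (\<Sum>k\<le>Suc n. c k * s powr (\<alpha> k - \<alpha> 0))" for s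
  define c' where "c' k = c (Suc k) * (\<alpha> (Suc k) - \<alpha> 0)" for k
  define \<alpha>' where "\<alpha>' k = \<alpha> (Suc k) - \<alpha> 0 - 1" for k
  define g' where "g' s = (\<Sum>k\<le>n. c' k * s powr \<alpha>' k)" for s
  have g_eq: "g s = s powr (- \<alpha> 0) * (\<Sum>k\<le>Suc n. c k * s powr \<alpha> k)" if "0 < s" for s
    unfolding g_def sum_distrib_left
    by (intro sum.cong) (simp_all add: powr_diff powr_minus divide_simps)
  have g_zero: "g (z i) = 0" if "i \<le> n" for i
    using g_eq[of "z i"] Suc.prems(4,5)[of i] that by simp
  have deriv: "(g has_real_derivative g' s) (at s)" if "0 < s" for s
  proof -
    have "(g has_real_derivative
        (\<Sum>k\<le>Suc n. c k * ((\<alpha> k - \<alpha> 0) * s powr (\<alpha> k - \<alpha> 0 - 1)))) (at s)"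
      unfolding g_def
      by (intro DERIV_sum DERIV_cmult has_real_derivative_powr that)
    also have "(\<Sum>k\<le>Suc n. c k * ((\<alpha> k - \<alpha> 0) * s powr (\<alpha> k - \<alpha> 0 - 1))) = g' s"
      unfolding g'_def c'_def \<alpha>'_def by (subst sum.atMost_Suc_shift) (simp add: mult.assoc)
    finally show ?thesis .
  qed
  have MVT: "\<exists>s. a < s \<and> s < b \<and> g b - g a = (b - a) * g' s" if "0 < a" "a < b" for a b
    using that deriv by (intro MVT2) auto
  \<comment> \<open>Rolle's theorem between consecutive zeros: the \<open>n + 1\<close> zeros of
    \<open>g\<close> yield \<open>n\<close> interlacing zeros of \<open>g'\<close>.\<close>
  have "\<exists>s. z i < s \<and> s < z (Suc i) \<and> g' s = 0" if "i < n" for i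
    using MVT[of "z i" "z (Suc i)"] mono_z[of i "Suc i"] Suc.prems(4)[of i] that
      g_zero[of i] g_zero[of "Suc i"]
    by auto
  then obtain y where y: "\<And>i. i < n \<Longrightarrow> z i < y i \<and> y i < z (Suc i) \<and> g' (y i) = 0"
    by metis
  have z_le: "z i \<le> z j" if "i \<le> j" "j \<le> n" for i j
    using mono_z[of i j] that by (cases "i = j") auto
  \<comment> \<open>Every \<open>y i\<close> lies to the left of \<open>z n\<close>, so the
    induction hypothesis covers all of \<open>s > z n\<close>. The leading coefficient stays
    positive because \<open>\<alpha> (Suc n) > \<alpha> 0\<close>.\<close>
  have g'_pos: "0 < g' s" if "z n < s" for s
    unfolding g'_def
  proof (rule Suc.IH)
    show "strict_mono_on {..n} \<alpha>'"
      using mono_\<alpha> by (auto simp: strict_mono_on_def \<alpha>'_def)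
    show "0 < c' n"
      using Suc.prems(2) mono_\<alpha>[of 0 "Suc n"] by (simp add: c'_def)
    show "strict_mono_on {..<n} y"
    proof (rule strict_mono_onI)
      fix i j assume "i \<in> {..<n}" "j \<in> {..<n}" "i < j"
      then show "y i < y j"
        using y[of i] y[of j] z_le[of "Suc i" j] by simp
    qed
    show "0 < s"
      using Suc.prems(4)[of n] that by simp
    fix i assume "i < n"
    then show "0 < y i" "y i < s" "(\<Sum>k\<le>n. c' k * y i powr \<alpha>' k) = 0"
      using y[of i] Suc.prems(4)[of i] z_le[of "Suc i" n] that by (auto simp: g'_def)
  qed
  \<comment> \<open>Since \<open>g (z n) = 0\<close>, the mean value theorem turns positivity of
    \<open>g'\<close> beyond \<open>z n\<close> into positivity of \<open>g t\<close>.\<close>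
  obtain s where "z n < s" "g t - g (z n) = (t - z n) * g' s"
    using MVT[of "z n" t] Suc.prems(4,7)[of n] by auto
  then have "0 < g t"
    using g'_pos Suc.prems(7)[of n] g_zero[of n] by simp
  then show ?case
    using g_eq[OF Suc.prems(6)] by (simp add: zero_less_mult_iff del: sum.atMost_Suc)
qed

lemma gen_vandermonde_det_pos:
  fixes \<alpha> x :: "nat \<Rightarrow> real"
  assumes "strict_mono_on {..<n} \<alpha>" and "strict_mono_on {..<n} x"
    and "\<And>i. i < n \<Longrightarrow> 0 < x i"
  shows "0 < det (mat n n (\<lambda>(i, j). x j powr \<alpha> i))"
  using assms
proof (induction n)
  case 0
  then show ?case by simp
next
  case (Suc n)
  define M where "M t = mat (Suc n) (Suc n) (\<lambda>(i, j). (if j = n then t else x j) powr \<alpha> i)" for t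
  \<comment> \<open>Cofactors along column \<open>n\<close> do not see the entries of that column,
    hence not \<open>t\<close>; the argument 0 is an arbitrary choice.\<close>
  define c where "c i = cofactor (M 0) i n" for i
  have M_carrier: "M t \<in> carrier_mat (Suc n) (Suc n)" for t
    by (simp add: M_def)
  have cof: "cofactor (M t) i n = c i" for t i
    unfolding c_def cofactor_def mat_delete_def M_def
    by (intro arg_cong2[of _ _ _ _ "(*)"] arg_cong[of _ _ det] refl) (auto simp: insert_index_def)
  have det_M: "det (M t) = (\<Sum>i\<le>n. c i * t powr \<alpha> i)" for t
  proof -
    have "det (M t) = (\<Sum>i<Suc n. M t $$ (i, n) * cofactor (M t) i n)"
      by (rule laplace_expansion_column[OF M_carrier]) simp
    also have "\<dots> = (\<Sum>i\<le>n. c i * t powr \<alpha> i)"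
      unfolding cof lessThan_Suc_atMost by (intro sum.cong) (auto simp: M_def)
    finally show ?thesis .
  qed
  \<comment> \<open>At \<open>t = x j\<close> the last column repeats column
    \<open>j\<close>.\<close>
  have det_zero: "det (M (x j)) = 0" if "j < n" for j
    by (rule det_identical_columns[OF M_carrier, of j n]) (use that in \<open>auto simp: M_def\<close>)
  \<comment> \<open>The cofactor at the corner \<open>(n, n)\<close> has sign
    \<open>(-1) ^ (n + n) = 1\<close>, so the leading coefficient is the smaller determinant
    itself.\<close>
  have "mat_delete (M 0) n n = mat n n (\<lambda>(i, j). x j powr \<alpha> i)"
    by (rule eq_matI) (auto simp: mat_delete_def M_def)
  then have "c n = det (mat n n (\<lambda>(i, j). x j powr \<alpha> i))"
    by (simp add: c_def cofactor_def)
  also have "\<dots> > 0"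
    using Suc.prems by (intro Suc.IH) (auto simp: strict_mono_on_def)
  finally have "0 < c n" .
  have "0 < (\<Sum>i\<le>n. c i * x n powr \<alpha> i)"
    by (rule gen_poly_pos_right_of_zeros[where z = x])
      (use Suc.prems \<open>0 < c n\<close> det_zero in
        \<open>auto simp: det_M lessThan_Suc_atMost strict_mono_on_def\<close>)
  also have "\<dots> = det (M (x n))"
    by (simp add: det_M)
  also have "M (x n) = mat (Suc n) (Suc n) (\<lambda>(i, j). x j powr \<alpha> i)"
    by (rule eq_matI) (auto simp: M_def)
  finally show ?case .
qed

theorem theorem17:
  fixes n :: nat and \<alpha> x :: "nat \<Rightarrow> real"
  assumes "n \<ge> 1"
    and "strict_mono_on {1..n} \<alpha>"
    and "0 < x 1"
    and "strict_mono_on {1..n} x"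
  shows "Delta n \<alpha> x > 0"
  unfolding Delta_def
proof (rule gen_vandermonde_det_pos)
  show "strict_mono_on {..<n} (\<lambda>i. \<alpha> (Suc i))" "strict_mono_on {..<n} (\<lambda>i. x (Suc i))"
    using assms(2,4) by (auto simp: strict_mono_on_def)
  show "0 < x (Suc i)" if "i < n" for i
    using assms(3) strict_mono_onD[OF assms(4), of 1 "Suc i"] that by (cases i) auto
qed

end
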